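(* Let $\mathcal{H}$ be a complex Hilbert space, and let $A$ be an antiunitary operator on $\mathcal{H}$ of finite order. Let $N\in\mathbb{N}$ be such that $A^{2N}=\mathrm{id}_{\mathcal{H}}$ and set $\zeta:=e^{i\pi/N}\in\mathbb{C}$. Then the following holds: (i) $A^2\in U(\mathcal{H})$ and $\mathcal{H}$ has a decomposition $$\mathcal{H}=\mathcal{H}_1\oplus \mathcal{H}_{-1} \oplus \bigoplus_{0<n<N/2}(\mathcal{H}_{\zeta^{2n}}\oplus \mathcal{H}_{\zeta^{-2n}})$$ into $A^2$-eigenspaces, where $\mathcal{H}_{\lambda}$ denotes the $A^2$-eigenspace corresponding to the eigenvalue $\lambda$. (ii) There is some $A$-stable subspace $\widetilde{\mathcal{H}}_1$ of $\mathcal{H}_1$ with $\dim\widetilde{\mathcal{H}}_1\leq 1$ such that the following holds: \begin{itemize} \item If $\dim\widetilde{\mathcal{H}}_1=1$, there is some unit vector $e_{j_0}\in \widetilde{\mathcal{H}}_1$ such that $Ae_{j_0}=e_{j_0}$. \item For each $n\in\mathbb{Z}$ with $0 \leq n\leq N/2$, there exists an orthonormal basis $\{e_j^+ ,e_j^-\mid j\in J_{\zeta^{2n}}\}$ of $\mathcal{H}_{\zeta^{2n}}+\mathcal{H}_{\zeta^{-2n}}$ (for $n > 0$) and of $\mathcal{H}_1\cap \widetilde{\mathcal{H}}_1^{\perp}$ (for $n = 0$) such that $A$ stabilises each plane $\mathbb{C} e_j^+\oplus\mathbb{C} e_j^-$, $j\in J_{\zeta^{2n}}$, and has the form $$\begin{pmatrix}0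 & \zeta^n \\ \zeta^{-n} & 0\end{pmatrix}\sigma_{e_j^+,e_j^-}$$ in the basis $\{e_j^+,e_j^-\}$. \end{itemize}
   Context: An operator $A$ on a complex Hilbert space $\mathcal{H}$ is antiunitary if it is antilinear (and bijective) and $\langle Ax,Ay\rangle=\overline{\langle x,y\rangle}$ for all $x,y\in\mathcal{H}$. Eigenspaces $\mathcal{H}_\lambda$ are allowed to be zero, and index sets $J_{\zeta^{2n}}$ to be empty. $\sigma_{e^+,e^-}$ is the complex conjugation on $\mathbb{C}e^+\oplus\mathbb{C}e^-$ with respect to the basis $\{e^+,e^-\}$ (antilinear, fixing $e^+$ and $e^-$); thus the matrix form means $Ae_j^+=\zeta^{-n}e_j^-$ and $Ae_j^-=\zeta^{n}e_j^+$. *)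

theory Defs
  imports "HOL-Analysis.Analysis"
begin

text \<open>
  Complex Hilbert spaces are a type class on top of the real normed spaces of HOL-Analysis, so
  that topology, norm and completeness are the library's. The inner product is antilinear in the
  first and linear in the second argument.
\<close>

class scaleC =
  fixes scaleC :: "complex \<Rightarrow> 'a \<Rightarrow> 'a"  (infixr \<open>*\<^sub>C\<close> 75)

class complex_vector = real_vector + scaleC +
  assumes scaleR_scaleC: "scaleR r x = complex_of_real r *\<^sub>C x"
    and scaleC_add_right: "a *\<^sub>C (x + y) = a *\<^sub>C x + a *\<^sub>C y"
    and scaleC_add_left: "(a + b) *\<^sub>C x = a *\<^sub>C x + b *\<^sub>C x"
    and scaleC_scaleC: "a *\<^sub>C b *\<^sub>C x = (a * b) *\<^sub>C x"

class complex_inner = real_normed_vector + complex_vector +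
  fixes cinner :: "'a \<Rightarrow> 'a \<Rightarrow> complex"
  assumes cinner_commute: "cinner x y = cnj (cinner y x)"
    and cinner_add_right: "cinner x (y + z) = cinner x y + cinner x z"
    and cinner_scaleC_right: "cinner x (a *\<^sub>C y) = a * cinner x y"
    and cinner_self_norm: "cinner x x = complex_of_real ((norm x)\<^sup>2)"

class chilbert_space = complex_inner + complete_space

global_interpretation complex_vector:
  vector_space "scaleC :: complex \<Rightarrow> 'a \<Rightarrow> 'a::complex_vector"
proof
  show "1 *\<^sub>C x = x" for x :: 'a
    using scaleR_scaleC[of 1 x] by simp
qed (simp_all add: scaleC_add_right scaleC_add_left scaleC_scaleC)

instantiation complex :: chilbert_space
begin

definition scaleC_complex :: "complex \<Rightarrow> complex \<Rightarrow> complex"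
  where "scaleC_complex = (*)"

definition cinner_complex :: "complex \<Rightarrow> complex \<Rightarrow> complex"
  where "cinner_complex x y = cnj x * y"

instance
proof
  show "cinner x x = complex_of_real ((norm x)\<^sup>2)" for x :: complex
    unfolding cinner_complex_def complex_norm_square by (rule mult.commute)
qed (simp_all add: scaleC_complex_def cinner_complex_def scaleR_conv_of_real algebra_simps)

end

definition unitary :: "('a::complex_inner \<Rightarrow> 'a) \<Rightarrow> bool" where
  "unitary U \<longleftrightarrow> bij U \<and> Vector_Spaces.linear scaleC scaleC U \<and>
     (\<forall>x y. cinner (U x) (U y) = cinner x y)"

definition antilinear :: "('a::complex_vector \<Rightarrow> 'a) \<Rightarrow> bool" where
  "antilinear A \<longleftrightarrow> (\<forall>x y. A (x + y) = A x + A y) \<and> (\<forall>c x. A (c *\<^sub>C x) = cnj c *\<^sub>C A x)"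

definition antiunitary :: "('a::complex_inner \<Rightarrow> 'a) \<Rightarrow> bool" where
  "antiunitary A \<longleftrightarrow> bij A \<and> antilinear A \<and> (\<forall>x y. cinner (A x) (A y) = cnj (cinner x y))"

definition eigenspace :: "('a::complex_vector \<Rightarrow> 'a) \<Rightarrow> complex \<Rightarrow> 'a set" where
  "eigenspace T c = {x. T x = c *\<^sub>C x}"

definition corth_compl :: "'a::complex_inner set \<Rightarrow> 'a set" where
  "corth_compl W = {x. \<forall>w\<in>W. cinner w x = 0}"

text \<open>
  Internal direct sum of Hilbert spaces: the whole space is the orthogonal direct sum of a finite
  list of closed subspaces. Using a list, members are counted with multiplicity: a nonzero
  subspace listed twice violates the condition.
\<close>

definition orthogonal_direct_sum :: "'a::complex_inner set list \<Rightarrow> bool" where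
  "orthogonal_direct_sum Vs \<longleftrightarrow>
     (\<forall>V\<in>set Vs. complex_vector.subspace V \<and> closed V) \<and>
     (\<forall>i<length Vs. \<forall>j<length Vs. i \<noteq> j \<longrightarrow> (\<forall>x\<in>Vs ! i. \<forall>y\<in>Vs ! j. cinner x y = 0)) \<and>
     (\<forall>x. \<exists>!xs. list_all2 (\<in>) xs Vs \<and> sum_list xs = x)"

text \<open>
  The constant \<^const>\<open>complex_vector.dim\<close> is 0 on infinite-dimensional spaces, so any bound on it
  has to be accompanied by finite-dimensionality.
\<close>

definition cfinite_dim :: "'a::complex_vector set \<Rightarrow> bool" where
  "cfinite_dim W \<longleftrightarrow> (\<exists>B. finite B \<and> W \<subseteq> complex_vector.span B)"

text \<open>Orthonormal basis in the Hilbert space sense: the span is only required to be dense.\<close>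

definition orthonormal_basis :: "'i set \<Rightarrow> ('i \<Rightarrow> 'a::complex_inner) \<Rightarrow> 'a set \<Rightarrow> bool" where
  "orthonormal_basis I e V \<longleftrightarrow>
     (\<forall>i\<in>I. \<forall>j\<in>I. cinner (e i) (e j) = (if i = j then 1 else 0)) \<and>
     closure (complex_vector.span (e ` I)) = V"

definition stabilises :: "('a \<Rightarrow> 'a) \<Rightarrow> 'a set \<Rightarrow> bool" where
  "stabilises A W \<longleftrightarrow> A ` W \<subseteq> W"

definition plane_vec :: "'a::complex_vector \<Rightarrow> 'a \<Rightarrow> complex ^ 2 \<Rightarrow> 'a" where
  "plane_vec p q c = c $ 1 *\<^sub>C p + c $ 2 *\<^sub>C q"

text \<open>
  On the plane with basis \<open>p, q\<close>, the map \<open>A\<close> is \<open>M\<close> composed with the complex conjugation with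
  respect to that basis.
\<close>

definition has_form_sigma ::
    "('a::complex_vector \<Rightarrow> 'a) \<Rightarrow> complex ^ 2 ^ 2 \<Rightarrow> 'a \<Rightarrow> 'a \<Rightarrow> bool" where
  "has_form_sigma A M p q \<longleftrightarrow>
     (\<forall>c. A (plane_vec p q c) = plane_vec p q (M *v (\<chi> i. cnj (c $ i))))"

end

theory Submission
  imports Defs
begin

text \<open>
  Write \<open>U = A\<^sup>2\<close>. Since \<open>U\<close> is unitary with \<open>U\<^sup>N = 1\<close>, averaging over the powers of \<open>U\<close> against the
  characters of the cyclic group of order \<open>N\<close> splits every vector into eigenvectors for \<open>N\<close>-th roots of
  unity (\<open>orthogonal_direct_sum_eigenspaces\<close>). The roots other than \<open>\<plusminus>1\<close> form the conjugate pairs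
  \<open>\<zeta>\<^sup>2\<^sup>n\<close>, \<open>\<zeta>\<^sup>-\<^sup>2\<^sup>n\<close> with \<open>0 < n < N / 2\<close> (\<open>roots_of_unity_list\<close>), which gives the decomposition of the space.

  As \<open>A\<close> is antilinear and commutes with \<open>U\<close>, it exchanges the eigenspaces for \<open>l\<close> and \<open>cnj l\<close>. The
  matrix form for \<open>l = \<zeta>\<^sup>2\<^sup>n\<close> says that \<open>e\<^sup>+\<close> is an eigenvector for \<open>l\<close> and that \<open>e\<^sup>-\<close> is \<open>\<zeta>\<^sup>n A e\<^sup>+\<close>. So the
  bases are obtained uniformly for all \<open>l\<close>: Zorn's lemma provides a maximal set \<open>S\<close> of eigenvectors for
  \<open>l\<close> such that \<open>S\<close> together with \<open>A ` S\<close> is orthonormal (\<open>maximal_paired_system_exists\<close>), and it remains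
  to see which eigenvectors for \<open>l\<close> are orthogonal to all of these.

  If \<open>l \<noteq> 1\<close>, there are none but \<open>0\<close>: the identity \<open>\<langle>x, A x\<rangle> = cnj l \<langle>x, A x\<rangle>\<close> makes any unit vector
  among them orthogonal to its image, so that it could be adjoined to \<open>S\<close> (\<open>residual_eigenspace_trivial\<close>).
  Hence the system is total in the sum of the two eigenspaces (\<open>maximal_paired_system_total\<close>).

  If \<open>l = 1\<close>, the operator \<open>A\<close> restricts to a conjugation of the remaining vectors. Two orthonormal fixed
  vectors \<open>f\<close>, \<open>g\<close> would allow \<open>(f + \<i> g) / \<surd>2\<close> to be adjoined, so at most one line is left over, and it is
  spanned by a fixed vector (\<open>residual_eigenspace_one_dim\<close>). That line, or \<open>0\<close>, is the exceptional subspace.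

  Passing from orthogonality to density of the span rests on the projection theorem
  (\<open>closure_subspace_nearest_point\<close>), the place where completeness enters.
\<close>

section \<open>Complex inner products\<close>

lemma cinner_add_left: "cinner (x + y) z = cinner x z + cinner y z"
  by (metis cinner_add_right cinner_commute complex_cnj_add)

lemma cinner_scaleC_left: "cinner (a *\<^sub>C x) y = cnj a * cinner x y"
  by (metis cinner_commute cinner_scaleC_right complex_cnj_mult)

lemma cinner_zero_right [simp]: "cinner x 0 = 0"
  using cinner_add_right[of x 0 0] by simp

lemma cinner_zero_left [simp]: "cinner 0 x = 0"
  using cinner_add_left[of 0 0 x] by simp

lemma cinner_minus_right: "cinner x (- y) = - cinner x y"
  using cinner_add_right[of x y "- y"] by (simp add: add_eq_0_iff)

lemma cinner_minus_left: "cinner (- x) y = - cinner x y"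
  using cinner_add_left[of x "- x" y] by (simp add: add_eq_0_iff)

lemma cinner_diff_right: "cinner x (y - z) = cinner x y - cinner x z"
  using cinner_add_right[of x y "- z"] by (simp add: cinner_minus_right)

lemma cinner_diff_left: "cinner (x - y) z = cinner x z - cinner y z"
  using cinner_add_left[of x "- y" z] by (simp add: cinner_minus_left)

lemmas cinner_algebra =
  cinner_add_left cinner_add_right cinner_diff_left cinner_diff_right
  cinner_scaleC_left cinner_scaleC_right

lemma cinner_sum_right: "cinner x (sum f I) = (\<Sum>i\<in>I. cinner x (f i))"
  by (induction I rule: infinite_finite_induct) (simp_all add: cinner_add_right)

lemma cinner_self_eq_0 [simp]: "cinner x x = 0 \<longleftrightarrow> x = 0"
  by (simp add: cinner_self_norm)

lemma cinner_eq_0_commute: "cinner x y = 0 \<longleftrightarrow> cinner y x = 0"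
  by (metis cinner_commute complex_cnj_zero)

lemma power2_norm_eq_cinner: "(norm x)\<^sup>2 = Re (cinner x x)"
  by (simp add: cinner_self_norm)

lemma norm_eq_iff_cinner: "norm x = norm y \<longleftrightarrow> cinner x x = cinner y y"
  unfolding cinner_self_norm by (simp only: of_real_eq_iff power2_eq_iff_nonneg norm_ge_zero)

lemma norm_scaleC: "norm (a *\<^sub>C x) = cmod a * norm (x :: 'a::complex_inner)"
proof -
  have "complex_of_real ((norm (a *\<^sub>C x))\<^sup>2) = complex_of_real ((cmod a * norm x)\<^sup>2)"
    unfolding cinner_self_norm[symmetric] cinner_scaleC_left cinner_scaleC_right
    using complex_norm_square[of a] by (simp add: cinner_self_norm power_mult_distrib mult.commute)
  then show ?thesis
    by (simp only: of_real_eq_iff power2_eq_iff_nonneg norm_ge_zero mult_nonneg_nonneg)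
qed

text \<open>The length lost by removing the component along \<open>v\<close>. Since what remains is nonnegative, this
  contains the Cauchy-Schwarz inequality; since a vector of minimal length cannot lose any, it also
  turns minimality into orthogonality.\<close>

lemma norm_diff_projection:
  fixes v q :: "'a::complex_inner"
  assumes "v \<noteq> 0"
  shows "(norm (q - (cinner v q / cinner v v) *\<^sub>C v))\<^sup>2 = (norm q)\<^sup>2 - (cmod (cinner v q))\<^sup>2 / (norm v)\<^sup>2"
proof -
  define c where "c = cinner v q"
  have qv: "cinner q v = cnj c"
    unfolding c_def by (rule cinner_commute)
  have vv: "cinner v v \<noteq> 0" "cnj (cinner v v) = cinner v v"
    using assms by (simp_all add: cinner_commute[symmetric])
  have "cinner (q - (c / cinner v v) *\<^sub>C v) (q - (c / cinner v v) *\<^sub>C v)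
      = cinner q q - c * cnj c / cinner v v"
    using vv by (simp add: cinner_algebra qv c_def[symmetric] field_simps)
  also have "\<dots> = complex_of_real ((norm q)\<^sup>2 - (cmod c)\<^sup>2 / (norm v)\<^sup>2)"
    by (simp only: cinner_self_norm complex_norm_square[symmetric] of_real_diff of_real_divide of_real_power)
  finally show ?thesis
    unfolding cinner_self_norm of_real_eq_iff c_def .
qed

lemma cinner_eq_0_if_norm_minimal:
  fixes v q :: "'a::complex_inner"
  assumes "\<And>c. norm q \<le> norm (q - c *\<^sub>C v)"
  shows "cinner v q = 0"
proof (cases "v = 0")
  case False
  have "(norm q)\<^sup>2 \<le> (norm q)\<^sup>2 - (cmod (cinner v q))\<^sup>2 / (norm v)\<^sup>2"
    unfolding norm_diff_projection[OF False, symmetric] by (intro power_mono assms norm_ge_zero)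
  then have "(cmod (cinner v q))\<^sup>2 / (norm v)\<^sup>2 \<le> 0"
    by linarith
  with False show ?thesis
    by (simp add: divide_le_0_iff)
qed simp

lemma cmod_cinner_le: "cmod (cinner v q) \<le> norm v * norm q"
proof (cases "v = 0")
  case False
  have "0 \<le> (norm q)\<^sup>2 - (cmod (cinner v q))\<^sup>2 / (norm v)\<^sup>2"
    unfolding norm_diff_projection[OF False, symmetric] by simp
  with False have "(cmod (cinner v q))\<^sup>2 \<le> (norm v * norm q)\<^sup>2"
    by (simp add: field_simps power_mult_distrib)
  then show ?thesis
    by (rule power2_le_imp_le) simp
qed simp

lemma bounded_linear_cinner_right: "bounded_linear (cinner w)"
proof (rule bounded_linear_intro)
  show "norm (cinner w x) \<le> norm x * norm w" for x
    using cmod_cinner_le[of w x] by (simp add: mult.commute)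
  show "cinner w (r *\<^sub>R x) = r *\<^sub>R cinner w x" for r x
    by (simp add: scaleR_scaleC cinner_scaleC_right scaleC_complex_def)
qed (rule cinner_add_right)

lemma bounded_linear_scaleC_right: "bounded_linear (\<lambda>x :: 'a::complex_inner. c *\<^sub>C x)"
proof (rule bounded_linear_intro)
  show "norm (c *\<^sub>C x) \<le> norm x * cmod c" for x :: 'a
    by (simp add: norm_scaleC)
  show "c *\<^sub>C r *\<^sub>R x = r *\<^sub>R c *\<^sub>C x" for r and x :: 'a
    by (simp add: scaleR_scaleC mult.commute)
qed (simp add: scaleC_add_right)

lemma subspace_corth_compl: "complex_vector.subspace (corth_compl X)"
  by (auto simp: complex_vector.subspace_def corth_compl_def cinner_algebra)

lemma closed_corth_compl: "closed (corth_compl X)"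
proof -
  have "corth_compl X = (\<Inter>w\<in>X. {x. cinner w x = 0})"
    by (auto simp: corth_compl_def)
  moreover have "closed {x. cinner w x = 0}" for w :: 'a
    by (intro closed_Collect_eq continuous_intros linear_continuous_on bounded_linear_cinner_right)
  ultimately show ?thesis
    by auto
qed

lemma corth_compl_eq_UNIV: "X \<subseteq> {0} \<Longrightarrow> corth_compl X = UNIV"
  by (auto simp: corth_compl_def)

lemma closure_span_subset:
  assumes "X \<subseteq> M" "complex_vector.subspace M" "closed M"
  shows "closure (complex_vector.span X) \<subseteq> M"
  using assms by (intro closure_minimal complex_vector.span_minimal)

text \<open>The projection theorem. By the parallelogram law, a sequence in \<open>S\<close> whose distances to \<open>x\<close>
  approach the infimum is Cauchy; its limit is a nearest point of the closure, and minimality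
  of the distance makes the difference orthogonal to \<open>S\<close>.\<close>

lemma closure_subspace_nearest_point:
  fixes x :: "'a::chilbert_space"
  assumes S: "complex_vector.subspace S"
  obtains p where "p \<in> closure S" "x - p \<in> corth_compl S"
proof -
  define d where "d = (INF s\<in>S. (norm (x - s))\<^sup>2)"
  have ne: "S \<noteq> {}"
    using complex_vector.subspace_0[OF S] by auto
  have bdd: "bdd_below ((\<lambda>s. (norm (x - s))\<^sup>2) ` S)"
    by (rule bdd_belowI2[of _ 0]) simp
  have d_le: "d \<le> (norm (x - s))\<^sup>2" if "s \<in> S" for s
    unfolding d_def using bdd that by (rule cINF_lower)
  have "\<exists>s\<in>S. (norm (x - s))\<^sup>2 < d + 1 / real (Suc k)" for k
    using cINF_less_iff[OF ne bdd, of "d + 1 / real (Suc k)"] unfolding d_def[symmetric] by simp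
  then obtain s where s: "\<And>k. s k \<in> S" "\<And>k. (norm (x - s k))\<^sup>2 < d + 1 / real (Suc k)"
    by metis
  have close: "(norm (s k - s l))\<^sup>2 \<le> 2 / real (Suc k) + 2 / real (Suc l)" for k l
  proof -
    define m where "m = (1/2) *\<^sub>C (s k + s l)"
    have mS: "m \<in> S"
      unfolding m_def using S s(1)
      by (intro complex_vector.subspace_scale complex_vector.subspace_add)
    have ds: "(x - s k) + (x - s l) = 2 *\<^sub>C (x - m)" "(x - s l) - (x - s k) = s k - s l"
      using scaleC_add_left[of 1 1 x]
      by (simp_all add: m_def complex_vector.scale_right_diff_distrib algebra_simps)
    have par: "(norm (a + b))\<^sup>2 + (norm (b - a))\<^sup>2 = 2 * (norm a)\<^sup>2 + 2 * (norm b)\<^sup>2" for a b :: 'a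
      by (simp add: power2_norm_eq_cinner cinner_algebra)
    have "4 * (norm (x - m))\<^sup>2 + (norm (s k - s l))\<^sup>2 = 2 * (norm (x - s k))\<^sup>2 + 2 * (norm (x - s l))\<^sup>2"
      using par[of "x - s k" "x - s l"] unfolding ds norm_scaleC by (simp add: power_mult_distrib)
    with d_le[OF mS] s(2)[of k] s(2)[of l] show ?thesis
      by simp
  qed
  have "Cauchy s"
  proof (rule metric_CauchyI)
    fix e :: real
    assume e: "e > 0"
    obtain K :: nat where K: "4 / e\<^sup>2 < real K"
      using reals_Archimedean2 by blast
    have "dist (s k) (s l) < e" if "k \<ge> K" "l \<ge> K" for k l
    proof -
      have "real K > 0"
        using K e by (smt (verit) divide_pos_pos zero_less_power)
      then have "2 / real (Suc k) \<le> 2 / real K" "2 / real (Suc l) \<le> 2 / real K"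
        using that by (auto intro!: divide_left_mono)
      with close[of k l] have "(norm (s k - s l))\<^sup>2 \<le> 4 / real K"
        by simp
      also have "4 / real K < e\<^sup>2"
        using K e \<open>real K > 0\<close> by (simp add: field_simps)
      finally show ?thesis
        using e by (simp add: dist_norm power2_less_imp_less)
    qed
    then show "\<exists>M. \<forall>m\<ge>M. \<forall>n\<ge>M. dist (s m) (s n) < e"
      by blast
  qed
  then obtain p where p: "s \<longlonglongrightarrow> p"
    using Cauchy_convergent convergent_def by blast
  have "p \<in> closure S"
    using p s(1) closure_sequential by blast
  moreover have "cinner v (x - p) = 0" if v: "v \<in> S" for v
  proof (rule cinner_eq_0_if_norm_minimal)
    fix c
    have "(\<lambda>k. (norm (x - s k))\<^sup>2) \<longlonglongrightarrow> (norm (x - p))\<^sup>2"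
      by (intro tendsto_intros p)
    moreover have "(\<lambda>k. d + 1 / real (Suc k)) \<longlonglongrightarrow> d + 0"
      using LIMSEQ_inverse_real_of_nat by (intro tendsto_intros) (simp add: field_simps)
    ultimately have "(norm (x - p))\<^sup>2 \<le> d + 0"
      by (rule LIMSEQ_le) (use s(2) less_imp_le in blast)
    also have "d + 0 \<le> (norm (x - p - c *\<^sub>C v))\<^sup>2"
    proof (rule LIMSEQ_le_const)
      show "(\<lambda>k. (norm (x - s k - c *\<^sub>C v))\<^sup>2) \<longlonglongrightarrow> (norm (x - p - c *\<^sub>C v))\<^sup>2"
        by (intro tendsto_intros p)
      have "d \<le> (norm (x - (s k + c *\<^sub>C v)))\<^sup>2" for k
        using S s(1) v
        by (intro d_le complex_vector.subspace_add complex_vector.subspace_scale)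
      then show "\<exists>K. \<forall>k\<ge>K. d + 0 \<le> (norm (x - s k - c *\<^sub>C v))\<^sup>2"
        by (simp add: diff_diff_eq)
    qed
    finally show "norm (x - p) \<le> norm (x - p - c *\<^sub>C v)"
      by (rule power2_le_imp_le) simp
  qed
  ultimately show ?thesis
    by (intro that) (auto simp: corth_compl_def)
qed

text \<open>A family that fails to span a closed subspace \<open>M\<close> misses exactly the part of \<open>M\<close> orthogonal to it.\<close>

lemma closure_span_eq_Int_corth_compl:
  fixes E :: "'a::chilbert_space set"
  assumes E: "E \<subseteq> M" and M: "complex_vector.subspace M" "closed M"
  shows "closure (complex_vector.span E) = M \<inter> corth_compl (M \<inter> corth_compl E)"
proof
  have "E \<subseteq> corth_compl (M \<inter> corth_compl E)"
    by (auto simp: corth_compl_def cinner_eq_0_commute)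
  with E M show sub: "closure (complex_vector.span E) \<subseteq> M \<inter> corth_compl (M \<inter> corth_compl E)"
    by (intro closure_span_subset complex_vector.subspace_inter closed_Int
        subspace_corth_compl closed_corth_compl) auto
  show "M \<inter> corth_compl (M \<inter> corth_compl E) \<subseteq> closure (complex_vector.span E)"
  proof
    fix x
    assume x: "x \<in> M \<inter> corth_compl (M \<inter> corth_compl E)"
    obtain p where p: "p \<in> closure (complex_vector.span E)" "x - p \<in> corth_compl (complex_vector.span E)"
      using closure_subspace_nearest_point[OF complex_vector.subspace_span] by blast
    have "x - p \<in> M \<inter> corth_compl E"
      using x p sub complex_vector.subspace_diff[OF M(1)] complex_vector.span_base[of _ E]
      by (auto simp: corth_compl_def)
    moreover have "x - p \<in> corth_compl (M \<inter> corth_compl E)"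
      using x p(1) sub complex_vector.subspace_diff[OF subspace_corth_compl] by blast
    ultimately have "cinner (x - p) (x - p) = 0"
      by (auto simp: corth_compl_def)
    with p(1) show "x \<in> closure (complex_vector.span E)"
      by simp
  qed
qed

section \<open>Spectral decomposition of unitary operators of finite order\<close>

text \<open>Orthogonality makes the summands of a decomposition unique: the difference of two
  decompositions sums to zero, and pairing with its \<open>i\<close>-th entry leaves that entry's squared norm.\<close>

lemma orthogonal_direct_sumI:
  fixes Vs :: "'a::complex_inner set list"
  assumes sub: "\<And>V. V \<in> set Vs \<Longrightarrow> complex_vector.subspace V" "\<And>V. V \<in> set Vs \<Longrightarrow> closed V"
    and orth: "\<And>i j x y. \<lbrakk>i < length Vs; j < length Vs; i \<noteq> j; x \<in> Vs ! i; y \<in> Vs ! j\<rbrakk> \<Longrightarrow> cinner x y = 0"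
    and ex: "\<And>x. \<exists>xs. list_all2 (\<in>) xs Vs \<and> sum_list xs = x"
  shows "orthogonal_direct_sum Vs"
proof -
  have unique: "xs = ys" if xs: "list_all2 (\<in>) xs Vs" and ys: "list_all2 (\<in>) ys Vs"
    and eq: "sum_list xs = sum_list ys" for xs ys
  proof (rule nth_equalityI)
    show len: "length xs = length ys"
      using xs ys by (simp add: list_all2_lengthD)
    fix i
    assume i: "i < length xs"
    have lens: "length xs = length Vs" "length ys = length Vs"
      using xs ys by (simp_all add: list_all2_lengthD)
    have d: "xs ! j - ys ! j \<in> Vs ! j" if "j < length Vs" for j
      using that xs ys sub(1) by (simp add: list_all2_conv_all_nth complex_vector.subspace_diff)
    have "0 = cinner (xs ! i - ys ! i) (\<Sum>j<length Vs. xs ! j - ys ! j)"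
      using eq by (simp add: sum_list_sum_nth atLeast0LessThan lens sum_subtractf)
    also have "\<dots> = (\<Sum>j<length Vs. if j = i then cinner (xs ! i - ys ! i) (xs ! i - ys ! i) else 0)"
      unfolding cinner_sum_right using d orth i lens by (intro sum.cong) auto
    also have "\<dots> = cinner (xs ! i - ys ! i) (xs ! i - ys ! i)"
      using i lens by simp
    finally have "xs ! i - ys ! i = 0"
      by (metis cinner_self_eq_0)
    then show "xs ! i = ys ! i"
      by simp
  qed
  with assms show ?thesis
    unfolding orthogonal_direct_sum_def by blast
qed

lemma unitaryD:
  assumes "unitary U"
  shows unitary_add: "U (x + y) = U x + U y"
    and unitary_scaleC: "U (c *\<^sub>C x) = c *\<^sub>C U x"
    and unitary_cinner: "cinner (U x) (U y) = cinner x y"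
  using assms by (simp_all add: unitary_def Vector_Spaces.linear_iff)

lemma bounded_linear_unitary:
  fixes U :: "'a::complex_inner \<Rightarrow> 'a"
  assumes "unitary U"
  shows "bounded_linear U"
proof (rule bounded_linear_intro)
  show "norm (U x) \<le> norm x * 1" for x
    using unitary_cinner[OF assms, of x x] norm_eq_iff_cinner[of "U x" x] by simp
qed (simp_all add: scaleR_scaleC unitaryD[OF assms])

lemma unitary_sum: "unitary U \<Longrightarrow> U (sum f I) = (\<Sum>i\<in>I. U (f i))"
  by (rule linear_sum[OF bounded_linear.linear[OF bounded_linear_unitary]])

lemma subspace_eigenspace:
  assumes "unitary U"
  shows "complex_vector.subspace (eigenspace U l)"
  using unitary_scaleC[OF assms, of 0]
  by (auto simp: complex_vector.subspace_def eigenspace_def unitaryD[OF assms]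
      scaleC_add_right scaleC_scaleC mult.commute)

lemma closed_eigenspace:
  fixes U :: "'a::complex_inner \<Rightarrow> 'a"
  assumes "unitary U"
  shows "closed (eigenspace U l)"
  unfolding eigenspace_def
  by (intro closed_Collect_eq linear_continuous_on bounded_linear_unitary assms
      bounded_linear_scaleC_right)

lemma cinner_eigenspace_eq_0:
  assumes U: "unitary U" and l: "cmod l = 1" "l \<noteq> m"
    and x: "x \<in> eigenspace U l" and y: "y \<in> eigenspace U m"
  shows "cinner x y = 0"
proof -
  have "l * cinner x y = l * cinner (l *\<^sub>C x) (m *\<^sub>C y)"
    using x y unitary_cinner[OF U, of x y] by (simp add: eigenspace_def)
  also have "\<dots> = (l * cnj l) * m * cinner x y"
    by (simp add: cinner_scaleC_left cinner_scaleC_right)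
  also have "l * cnj l = 1"
    using l(1) complex_norm_square[of l] by simp
  finally have "l * cinner x y = m * cinner x y"
    by simp
  then show ?thesis
    using l(2) by simp
qed

lemma sum_roots_of_unity_power:
  assumes "k < N"
  shows "(\<Sum>l | l ^ N = 1. (cnj l) ^ k) = (if k = 0 then of_nat N else 0)"
proof -
  have N: "N > 0"
    using assms by simp
  define w where "w = cis (- (2 * pi * real k / real N))"
  have "(\<Sum>l | l ^ N = 1. (cnj l) ^ k) = (\<Sum>m<N. cnj (cis (2 * pi * real m / real N)) ^ k)"
    by (rule sum.reindex_bij_betw[OF Complex.bij_betw_roots_unity[OF N], symmetric])
  also have "\<dots> = (\<Sum>m<N. w ^ m)"
    unfolding w_def cis_cnj Complex.DeMoivre by (intro sum.cong refl arg_cong[where f = cis]) simp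
  also have "\<dots> = (if k = 0 then of_nat N else 0)"
  proof (cases "k = 0")
    case False
    have "w ^ N = 1"
      using N cis_multiple_2pi[of "- real k"] by (simp add: w_def Complex.DeMoivre)
    moreover have "w \<noteq> 1"
    proof
      assume "w = 1"
      then have "cis (2 * pi * real k / real N) = 1"
        unfolding w_def by (metis cis_cnj complex_cnj_cnj complex_cnj_one)
      then have "k = 0"
        using bij_betw_imp_inj_on[OF Complex.bij_betw_roots_unity[OF N]] assms N
        by (auto dest: inj_onD[where y = 0])
      with False show False
        by simp
    qed
    ultimately show ?thesis
      using False geometric_sum[of w N] by simp
  qed (simp add: w_def)
  finally show ?thesis .
qed

text \<open>The projection onto an eigenspace is an average over the cyclic group generated by \<open>U\<close>,
  weighted by the character belonging to the eigenvalue.\<close>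

definition cyclic_average :: "nat \<Rightarrow> ('a::complex_vector \<Rightarrow> 'a) \<Rightarrow> complex \<Rightarrow> 'a \<Rightarrow> 'a" where
  "cyclic_average N U l x = (1 / of_nat N) *\<^sub>C (\<Sum>k<N. (cnj l) ^ k *\<^sub>C (U ^^ k) x)"

lemma cyclic_average_in_eigenspace:
  assumes U: "unitary U" "U ^^ N = id" and N: "N > 0" and l: "l ^ N = 1"
  shows "cyclic_average N U l x \<in> eigenspace U l"
proof -
  have "cmod l = 1"
    using l N by (metis norm_one norm_power power_eq_1_iff norm_ge_zero less_numeral_extra(3))
  then have ll: "l * cnj l = 1"
    using complex_norm_square[of l] by simp
  define f where "f k = (cnj l) ^ k *\<^sub>C (U ^^ k) x" for k
  have "f N = f 0"
    using U(2) l by (simp add: f_def complex_cnj_power[symmetric])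
  then have shift: "(\<Sum>k<N. f (Suc k)) = (\<Sum>k<N. f k)"
    using sum.lessThan_Suc_shift[of f N] by simp
  have "U (f k) = l *\<^sub>C f (Suc k)" for k
    using ll by (simp add: f_def unitary_scaleC[OF U(1)] mult.assoc[symmetric])
  then have "U (sum f {..<N}) = l *\<^sub>C (\<Sum>k<N. f (Suc k))"
    by (simp add: unitary_sum[OF U(1)] complex_vector.scale_sum_right)
  then show ?thesis
    unfolding cyclic_average_def f_def[symmetric] eigenspace_def shift
    by (simp add: unitary_scaleC[OF U(1)] mult.commute)
qed

lemma sum_cyclic_average:
  assumes "N > 0"
  shows "(\<Sum>l | l ^ N = 1. cyclic_average N U l x) = x"
proof -
  have "(\<Sum>l | l ^ N = 1. cyclic_average N U l x)
      = (1 / of_nat N) *\<^sub>C (\<Sum>k<N. (\<Sum>l | l ^ N = 1. (cnj l) ^ k) *\<^sub>C (U ^^ k) x)"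
    unfolding cyclic_average_def complex_vector.scale_sum_right[symmetric] complex_vector.scale_sum_left
    by (subst sum.swap) simp
  also have "(\<Sum>k<N. (\<Sum>l | l ^ N = 1. (cnj l) ^ k) *\<^sub>C (U ^^ k) x)
      = (\<Sum>k<N. if k = 0 then of_nat N *\<^sub>C x else 0)"
    by (intro sum.cong refl) (auto simp: sum_roots_of_unity_power)
  finally show ?thesis
    using assms by simp
qed

text \<open>Listed scalars that are no \<open>N\<close>-th roots of unity are harmless: their eigenspaces are zero,
  and they receive the component \<open>0\<close>.\<close>

lemma orthogonal_direct_sum_eigenspaces:
  fixes U :: "'a::complex_inner \<Rightarrow> 'a"
  assumes U: "unitary U" "U ^^ N = id" and N: "N > 0"
    and L: "distinct L" "\<And>l. l \<in> set L \<Longrightarrow> cmod l = 1" "{l. l ^ N = 1} \<subseteq> set L"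
  shows "orthogonal_direct_sum (map (eigenspace U) L)"
proof (rule orthogonal_direct_sumI)
  show "complex_vector.subspace V" "closed V" if "V \<in> set (map (eigenspace U) L)" for V
    using that subspace_eigenspace[OF U(1)] closed_eigenspace[OF U(1)] by auto
  show "cinner x y = 0" if "i < length (map (eigenspace U) L)" "j < length (map (eigenspace U) L)"
    "i \<noteq> j" "x \<in> map (eigenspace U) L ! i" "y \<in> map (eigenspace U) L ! j" for i j x y
    using that L(1) by (intro cinner_eigenspace_eq_0[OF U(1) L(2)[of "L ! i"], of "L ! j"])
      (auto simp: nth_eq_iff_index_eq)
  show "\<exists>xs. list_all2 (\<in>) xs (map (eigenspace U) L) \<and> sum_list xs = x" for x
  proof (intro exI conjI)
    define p where "p l = (if l ^ N = 1 then cyclic_average N U l x else 0)" for l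
    have "p l \<in> eigenspace U l" for l
      using cyclic_average_in_eigenspace[OF U N] complex_vector.subspace_0[OF subspace_eigenspace[OF U(1)]]
      by (auto simp: p_def)
    then show "list_all2 (\<in>) (map p L) (map (eigenspace U) L)"
      by (simp add: list_all2_conv_all_nth)
    have "sum_list (map p L) = sum p (set L)"
      using L(1) by (rule sum_list_distinct_conv_sum_set)
    also have "\<dots> = sum p {l. l ^ N = 1}"
      using L(3) by (intro sum.mono_neutral_right) (auto simp: p_def)
    also have "\<dots> = x"
      using sum_cyclic_average[OF N, of U x] by (simp add: p_def)
    finally show "sum_list (map p L) = x" .
  qed
qed

lemma distinct_concat_pairs:
  assumes "distinct ns" "inj_on f (set ns)" "inj_on g (set ns)" "\<And>n m. \<lbrakk>n \<in> set ns; m \<in> set ns\<rbrakk> \<Longrightarrow> f n \<noteq> g m"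
  shows "distinct (concat (map (\<lambda>n. [f n, g n]) ns))"
  using assms
proof (induction ns)
  case (Cons a ns)
  then have "f a \<noteq> g n" "g a \<noteq> f n" if "n \<in> insert a (set ns)" for n
    using that by (metis list.simps(15) insertI1)+
  with Cons show ?case
    by (auto simp: inj_on_def)
qed simp

text \<open>The listed scalars are \<open>\<zeta>\<^sup>2\<^sup>n\<close> with \<open>\<zeta> = cis (\<pi> / N)\<close>: one pair of conjugate roots of unity for
  each angle strictly between \<open>0\<close> and \<open>\<pi>\<close>, together with \<open>\<plusminus>1\<close>. The imaginary part separates the
  two members of a pair and the real part separates different pairs.\<close>

lemma roots_of_unity_list:
  fixes N :: nat
  assumes N: "N > 0" and z: "z = cis (pi / real N)"
  defines "L \<equiv> [1, - 1] @ concat (map (\<lambda>n. [z powi (2 * n), z powi (- 2 * n)])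
    [n \<leftarrow> [1..int N]. real_of_int n < real N / 2])"
  shows "distinct L" and "\<And>l. l \<in> set L \<Longrightarrow> cmod l = 1" and "{l. l ^ N = 1} \<subseteq> set L"
proof -
  define ns where "ns = [n \<leftarrow> [1..int N]. real_of_int n < real N / 2]"
  define t where "t n = 2 * pi * real_of_int n / real N" for n
  have pos: "z powi (2 * n) = cis (t n)" and neg: "z powi (- 2 * n) = cis (- t n)" for n
    using cis_power_int[of "pi / real N" "2 * n"] cis_power_int[of "pi / real N" "- 2 * n"]
    by (simp_all add: z t_def mult_ac)
  have ns: "n \<in> set ns \<longleftrightarrow> 0 < n \<and> real_of_int n < real N / 2" for n
    unfolding ns_def by auto
  have t: "0 < t n" "t n < pi" if "n \<in> set ns" for n
    using that N by (auto simp: ns t_def field_simps)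
  have Im_pos: "sin (t n) > 0" if "n \<in> set ns" for n
    using t[OF that] by (rule sin_gt_zero)
  have inj: "n = m" if "cos (t n) = cos (t m)" "n \<in> set ns" "m \<in> set ns" for n m
  proof -
    have "t n = t m"
      using t[OF that(2)] t[OF that(3)] by (intro cos_inj_pi[OF _ _ _ _ that(1)]) simp_all
    with N show ?thesis
      unfolding t_def by simp
  qed
  have L_eq: "L = [1, - 1] @ concat (map (\<lambda>n. [cis (t n), cis (- t n)]) ns)"
    by (simp only: L_def ns_def[symmetric] pos neg)
  have "distinct (concat (map (\<lambda>n. [cis (t n), cis (- t n)]) ns))"
  proof (rule distinct_concat_pairs)
    show "distinct ns"
      by (simp add: ns_def)
    show "inj_on (\<lambda>n. cis (t n)) (set ns)" "inj_on (\<lambda>n. cis (- t n)) (set ns)"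
      using inj by (auto simp: inj_on_def complex_eq_iff)
    show "cis (t n) \<noteq> cis (- t m)" if "n \<in> set ns" "m \<in> set ns" for n m
      using Im_pos[OF that(1)] Im_pos[OF that(2)] by (auto simp: complex_eq_iff)
  qed
  then show "distinct L"
    by (auto simp: L_eq complex_eq_iff dest!: Im_pos)
  show "cmod l = 1" if "l \<in> set L" for l
    using that by (auto simp: L_eq)
  show "{l. l ^ N = 1} \<subseteq> set L"
  proof
    fix l :: complex
    assume "l \<in> {l. l ^ N = 1}"
    then obtain k where k: "k < N" and l: "l = cis (2 * pi * real k / real N)"
      using Complex.bij_betw_roots_unity[OF N] by (auto simp: bij_betw_def)
    consider "k = 0" | "0 < k" "2 * k < N" | "2 * k = N" | "2 * k > N"
      by linarith
    then show "l \<in> set L"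
    proof cases
      case 1
      with l show ?thesis
        by (simp add: L_eq)
    next
      case 2
      then have "int k \<in> set ns"
        by (simp add: ns)
      moreover have "l = cis (t (int k))"
        by (simp add: l t_def)
      ultimately show ?thesis
        by (auto simp: L_eq)
    next
      case 3
      then have "2 * pi * real k / real N = pi"
        using N by (simp add: field_simps flip: of_nat_mult)
      with l show ?thesis
        by (simp add: L_eq)
    next
      case 4
      then have "int (N - k) \<in> set ns"
        using k by (simp add: ns of_nat_diff)
      moreover have "l = cis (2 * pi) * cis (- t (int (N - k)))"
        unfolding cis_mult using k N by (simp add: l t_def of_nat_diff field_simps)
      ultimately show ?thesis
        by (auto simp: L_eq)
    qed
  qed
qed

section \<open>Antiunitary operators and maximal paired systems\<close>

lemma antiunitaryD:
  assumes "antiunitary A"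
  shows antiunitary_add: "A (x + y) = A x + A y"
    and antiunitary_scaleC: "A (c *\<^sub>C x) = cnj c *\<^sub>C A x"
    and antiunitary_cinner: "cinner (A x) (A y) = cnj (cinner x y)"
  using assms by (simp_all add: antiunitary_def antilinear_def)

lemma funpow_2_apply: "(A ^^ 2) x = A (A x)"
  by (simp add: numeral_2_eq_2)

lemma unitary_antiunitary_square:
  fixes A :: "'a::complex_inner \<Rightarrow> 'a"
  assumes "antiunitary A"
  shows "unitary (A ^^ 2)"
  using assms bij_fn[of A 2]
  by (simp add: unitary_def Vector_Spaces.linear_iff complex_vector.vector_space_axioms
      funpow_2_apply antiunitaryD[OF assms] antiunitary_def[of A])

lemma antiunitary_eigenspace:
  assumes "antiunitary A" "x \<in> eigenspace (A ^^ 2) l"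
  shows "A x \<in> eigenspace (A ^^ 2) (cnj l)"
  using assms(2) antiunitary_scaleC[OF assms(1), of l x] by (simp add: eigenspace_def funpow_2_apply)

text \<open>Inserting \<open>A\<close> on both sides moves it from the second argument to the first, at the price
  of the eigenvalue.\<close>

lemma cinner_antiunitary_swap:
  assumes A: "antiunitary A" and y: "y \<in> eigenspace (A ^^ 2) l"
  shows "cinner x (A y) = cnj l * cnj (cinner (A x) y)"
proof -
  have "cnj (cinner x (A y)) = cinner (A x) (A (A y))"
    by (simp add: antiunitary_cinner[OF A])
  also have "\<dots> = l * cinner (A x) y"
    using y by (simp add: eigenspace_def funpow_2_apply cinner_scaleC_right)
  finally show ?thesis
    by (metis complex_cnj_cnj complex_cnj_mult)
qed

text \<open>The condition says that the vectors \<open>e\<close> and \<open>A e\<close>, for \<open>e\<close> in \<open>S\<close>, together form an orthonormal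
  family; orthonormality of \<open>A ` S\<close> follows from that of \<open>S\<close>.\<close>

definition paired_system :: "('a::complex_inner \<Rightarrow> 'a) \<Rightarrow> complex \<Rightarrow> 'a set \<Rightarrow> bool" where
  "paired_system A l S \<longleftrightarrow> S \<subseteq> eigenspace (A ^^ 2) l \<and>
     (\<forall>e\<in>S. \<forall>f\<in>S. cinner e f = (if e = f then 1 else 0) \<and> cinner e (A f) = 0)"

definition maximal_paired_system :: "('a::complex_inner \<Rightarrow> 'a) \<Rightarrow> complex \<Rightarrow> 'a set \<Rightarrow> bool" where
  "maximal_paired_system A l S \<longleftrightarrow>
     paired_system A l S \<and> (\<forall>T. paired_system A l T \<longrightarrow> S \<subseteq> T \<longrightarrow> T = S)"

definition residual_eigenspace :: "('a::complex_inner \<Rightarrow> 'a) \<Rightarrow> complex \<Rightarrow> 'a set \<Rightarrow> 'a set" where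
  "residual_eigenspace A l S = eigenspace (A ^^ 2) l \<inter> corth_compl (S \<union> A ` S)"

lemma maximal_paired_system_exists: "\<exists>S. maximal_paired_system A l S"
proof -
  have "\<exists>M\<in>Collect (paired_system A l). \<forall>X\<in>Collect (paired_system A l). M \<subseteq> X \<longrightarrow> X = M"
  proof (rule subset_Zorn')
    fix C
    assume "subset.chain (Collect (paired_system A l)) C"
    then have C: "\<And>X. X \<in> C \<Longrightarrow> paired_system A l X" "\<And>X Y. \<lbrakk>X \<in> C; Y \<in> C\<rbrakk> \<Longrightarrow> X \<subseteq> Y \<or> Y \<subseteq> X"
      unfolding subset_chain_def by auto
    have "cinner e f = (if e = f then 1 else 0) \<and> cinner e (A f) = 0" if ef: "e \<in> \<Union>C" "f \<in> \<Union>C" for e f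
    proof -
      obtain X Y where "X \<in> C" "e \<in> X" "Y \<in> C" "f \<in> Y"
        using ef by blast
      then obtain Z where "Z \<in> C" "e \<in> Z" "f \<in> Z"
        using C(2)[of X Y] by blast
      with C(1) show ?thesis
        by (auto simp: paired_system_def)
    qed
    moreover have "\<Union>C \<subseteq> eigenspace (A ^^ 2) l"
      using C(1) by (auto simp: paired_system_def)
    ultimately show "\<Union>C \<in> Collect (paired_system A l)"
      by (simp add: paired_system_def)
  qed
  then show ?thesis
    by (auto simp: maximal_paired_system_def)
qed

text \<open>Orthogonality of \<open>A x\<close> to the system is inherited from \<open>x\<close>, so the angle between \<open>x\<close> and \<open>A x\<close> is
  the only possible obstruction to adjoining \<open>x\<close>.\<close>

lemma maximal_paired_system_no_extension:
  assumes A: "antiunitary A" and S: "maximal_paired_system A l S"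
    and x: "x \<in> residual_eigenspace A l S" "cinner x x = 1"
  shows "cinner x (A x) \<noteq> 0"
proof
  assume xA: "cinner x (A x) = 0"
  have PS: "paired_system A l S"
    using S by (simp add: maximal_paired_system_def)
  have xl: "x \<in> eigenspace (A ^^ 2) l"
    and orth: "\<And>e. e \<in> S \<Longrightarrow> cinner e x = 0" "\<And>e. e \<in> S \<Longrightarrow> cinner (A e) x = 0"
    using x by (auto simp: residual_eigenspace_def corth_compl_def)
  have orth': "cinner x e = 0" "cinner x (A e) = 0" "cinner e (A x) = 0" if "e \<in> S" for e
    using orth[OF that] cinner_eq_0_commute[of x] cinner_antiunitary_swap[OF A xl, of e] by auto
  have notin: "x \<notin> S"
    using orth(1)[of x] x(2) by auto
  have "paired_system A l (insert x S)"
    using PS xl xA x(2) orth orth' notin by (auto simp: paired_system_def)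
  then have "insert x S = S"
    using S by (auto simp: maximal_paired_system_def)
  with notin show False
    by auto
qed

lemma cinner_normalize:
  fixes x :: "'a::complex_inner"
  assumes "x \<noteq> 0"
  defines "u \<equiv> (1 / norm x) *\<^sub>R x"
  shows "cinner u u = 1"
  using assms by (simp add: cinner_self_norm)

text \<open>For an eigenvalue other than \<open>1\<close>, every vector is automatically orthogonal to its image
  under \<open>A\<close>, so that nothing obstructs the extension of a paired system.\<close>

lemma residual_eigenspace_trivial:
  assumes A: "antiunitary A" and S: "maximal_paired_system A l S" and l: "l \<noteq> 1"
    and x: "x \<in> residual_eigenspace A l S"
  shows "x = 0"
proof (rule ccontr)
  assume "x \<noteq> 0"
  define u where "u = (1 / norm x) *\<^sub>R x"
  have u: "u \<in> residual_eigenspace A l S"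
    unfolding u_def scaleR_scaleC residual_eigenspace_def
    using x by (intro complex_vector.subspace_scale complex_vector.subspace_inter subspace_corth_compl
        subspace_eigenspace unitary_antiunitary_square A) (simp add: residual_eigenspace_def)
  have "cinner u (A u) = cnj l * cnj (cinner (A u) u)"
    using u by (intro cinner_antiunitary_swap[OF A]) (simp add: residual_eigenspace_def)
  also have "cnj (cinner (A u) u) = cinner u (A u)"
    by (rule cinner_commute[symmetric])
  finally have "cinner u (A u) = 0"
    using l by (metis complex_cnj_cnj complex_cnj_one mult_cancel_right1 mult.commute)
  with maximal_paired_system_no_extension[OF A S u] cinner_normalize[OF \<open>x \<noteq> 0\<close>] show False
    by (simp add: u_def)
qed

text \<open>On the eigenspace for \<open>1\<close>, \<open>A\<close> is an involution: \<open>x + A x\<close> is fixed, and if it vanishes then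
  antilinearity makes \<open>\<i> x\<close> fixed.\<close>

lemma antiunitary_fixed_unit_vector:
  assumes A: "antiunitary A" and L: "complex_vector.subspace L" "L \<subseteq> eigenspace (A ^^ 2) 1"
    "\<And>x. x \<in> L \<Longrightarrow> A x \<in> L"
    and x: "x \<in> L" "x \<noteq> 0"
  shows "\<exists>f\<in>L. cinner f f = 1 \<and> A f = f"
proof -
  have AA: "A (A x) = x"
    using x L(2) by (auto simp: eigenspace_def funpow_2_apply)
  obtain g where g: "g \<in> L" "A g = g" "g \<noteq> 0"
  proof (cases "x + A x = 0")
    case True
    have "A (\<i> *\<^sub>C x) = \<i> *\<^sub>C x"
      using True by (simp add: antiunitary_scaleC[OF A] add_eq_0_iff)
    with x L(1) show ?thesis
      by (intro that[of "\<i> *\<^sub>C x"]) (auto intro: complex_vector.subspace_scale)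
  next
    case False
    with x L AA show ?thesis
      by (intro that[of "x + A x"]) (auto intro: complex_vector.subspace_add simp: antiunitary_add[OF A])
  qed
  show ?thesis
  proof (intro bexI conjI)
    show "cinner ((1 / norm g) *\<^sub>R g) ((1 / norm g) *\<^sub>R g) = 1"
      by (rule cinner_normalize[OF g(3)])
    show "A ((1 / norm g) *\<^sub>R g) = (1 / norm g) *\<^sub>R g"
      by (simp add: scaleR_scaleC antiunitary_scaleC[OF A] g(2))
    show "(1 / norm g) *\<^sub>R g \<in> L"
      unfolding scaleR_scaleC by (intro complex_vector.subspace_scale L g(1))
  qed
qed

lemma subspace_residual_eigenspace:
  assumes "antiunitary A"
  shows "complex_vector.subspace (residual_eigenspace A l S)"
  unfolding residual_eigenspace_def
  by (intro complex_vector.subspace_inter subspace_corth_compl subspace_eigenspace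
      unitary_antiunitary_square assms)

lemma residual_eigenspace_stable:
  assumes A: "antiunitary A" and S: "maximal_paired_system A 1 S" and x: "x \<in> residual_eigenspace A 1 S"
  shows "A x \<in> residual_eigenspace A 1 S"
proof -
  have xl: "x \<in> eigenspace (A ^^ 2) 1"
    and orth: "\<And>e. e \<in> S \<Longrightarrow> cinner e x = 0" "\<And>e. e \<in> S \<Longrightarrow> cinner (A e) x = 0"
    using x by (auto simp: residual_eigenspace_def corth_compl_def)
  have "A x \<in> eigenspace (A ^^ 2) 1"
    using antiunitary_eigenspace[OF A xl] by simp
  moreover have "cinner e (A x) = 0" "cinner (A e) (A x) = 0" if "e \<in> S" for e
    using orth[OF that] by (simp_all add: cinner_antiunitary_swap[OF A xl, of e] antiunitary_cinner[OF A])
  ultimately show ?thesis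
    by (auto simp: residual_eigenspace_def corth_compl_def)
qed

text \<open>Two orthogonal fixed unit vectors \<open>f\<close> and \<open>g\<close> give \<open>e = (f + \<i> g) / \<surd>2\<close> with \<open>A e = (f - \<i> g) / \<surd>2\<close>
  orthogonal to \<open>e\<close>, contradicting maximality. So a single fixed vector spans what is left.\<close>

lemma residual_eigenspace_one_dim:
  assumes A: "antiunitary A" and S: "maximal_paired_system A 1 S"
    and f: "f \<in> residual_eigenspace A 1 S" "cinner f f = 1" "A f = f"
  shows "residual_eigenspace A 1 S \<subseteq> complex_vector.span {f}"
proof
  let ?K = "residual_eigenspace A 1 S"
  note subK = subspace_residual_eigenspace[OF A]
  fix y
  assume y: "y \<in> ?K"
  define z where "z = y - cinner f y *\<^sub>C f"
  have "z = 0"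
  proof (rule ccontr)
    assume z0: "z \<noteq> 0"
    let ?L = "?K \<inter> corth_compl {f}"
    have "cinner f (A x) = cnj (cinner f x)" for x
      using antiunitary_cinner[OF A, of f x] f(3) by simp
    then have stable: "A x \<in> ?L" if "x \<in> ?L" for x
      using that residual_eigenspace_stable[OF A S] by (auto simp: corth_compl_def)
    have "z \<in> ?L"
      using complex_vector.subspace_diff[OF subK y complex_vector.subspace_scale[OF subK f(1)]] f(2)
      by (auto simp: z_def corth_compl_def cinner_algebra)
    moreover have "complex_vector.subspace ?L"
      by (intro complex_vector.subspace_inter subK subspace_corth_compl)
    ultimately obtain g where g: "g \<in> ?L" "cinner g g = 1" "A g = g"
      using antiunitary_fixed_unit_vector[OF A, of ?L z] stable z0
      by (auto simp: residual_eigenspace_def)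
    have fg: "cinner f g = 0" "cinner g f = 0"
      using g(1) by (auto simp: corth_compl_def cinner_eq_0_commute[of g f])
    define e where "e = complex_of_real (1 / sqrt 2) *\<^sub>C (f + \<i> *\<^sub>C g)"
    have Ae: "A e = complex_of_real (1 / sqrt 2) *\<^sub>C (f - \<i> *\<^sub>C g)"
      unfolding e_def antiunitaryD[OF A] f(3) g(3) by simp
    have half: "complex_of_real (1 / sqrt 2) * complex_of_real (1 / sqrt 2) = 1 / 2"
      unfolding of_real_mult[symmetric] by simp
    have "cinner (f + \<i> *\<^sub>C g) (f + \<i> *\<^sub>C g) = 2" "cinner (f + \<i> *\<^sub>C g) (f - \<i> *\<^sub>C g) = 0"
      by (simp_all add: cinner_algebra f(2) g(2) fg)
    then have "cinner e e = 1" "cinner e (A e) = 0"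
      unfolding Ae unfolding e_def cinner_scaleC_left[of "complex_of_real _"]
        cinner_scaleC_right[of _ "complex_of_real _"] complex_cnj_complex_of_real
        mult.assoc[symmetric] half by simp_all
    moreover have "e \<in> ?K"
      unfolding e_def using f(1) g(1)
      by (intro complex_vector.subspace_scale complex_vector.subspace_add subK) auto
    ultimately show False
      using maximal_paired_system_no_extension[OF A S] by blast
  qed
  then show "y \<in> complex_vector.span {f}"
    by (simp add: z_def complex_vector.span_singleton)
qed

section \<open>Orthonormal bases from paired systems\<close>

text \<open>The sum of two distinct eigenspaces is the kernel of \<open>(U - l) (U - m)\<close>, hence closed.\<close>

lemma eigenspace_plus_eigenspace:
  fixes U :: "'a::complex_inner \<Rightarrow> 'a"
  assumes U: "unitary U" and lm: "l \<noteq> m"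
  shows "eigenspace U l + eigenspace U m = {x. U (U x) + (l * m) *\<^sub>C x = (l + m) *\<^sub>C U x}"
proof (intro equalityI subsetI)
  fix x
  assume "x \<in> eigenspace U l + eigenspace U m"
  then obtain a b where "x = a + b" "U a = l *\<^sub>C a" "U b = m *\<^sub>C b"
    by (auto simp: set_plus_def eigenspace_def)
  then show "x \<in> {x. U (U x) + (l * m) *\<^sub>C x = (l + m) *\<^sub>C U x}"
    by (simp add: unitaryD[OF U] scaleC_add_right scaleC_add_left algebra_simps)
next
  fix x
  assume "x \<in> {x. U (U x) + (l * m) *\<^sub>C x = (l + m) *\<^sub>C U x}"
  then have UU: "U (U x) = (l + m) *\<^sub>C U x + (- (l * m)) *\<^sub>C x"
    by (simp add: algebra_simps)
  define part where "part p q = (1 / (p - q)) *\<^sub>C (U x + (- q) *\<^sub>C x)" for p q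
  have part: "part p q \<in> eigenspace U p" if "p + q = l + m" "p * q = l * m" for p q
  proof -
    have "U (U x) + (- q) *\<^sub>C U x = (l + m + (- q)) *\<^sub>C U x + (- (l * m)) *\<^sub>C x"
      unfolding UU scaleC_add_left by simp
    also have "\<dots> = p *\<^sub>C (U x + (- q) *\<^sub>C x)"
      unfolding that[symmetric] by (simp add: scaleC_add_right scaleC_scaleC complex_vector.scale_right_diff_distrib)
    finally show ?thesis
      by (simp add: eigenspace_def part_def unitaryD[OF U] mult.commute del: complex_vector.scale_minus_left)
  qed
  have "part l m + part m l = (1 / (l - m)) *\<^sub>C (U x + (- m) *\<^sub>C x) + (- (1 / (l - m))) *\<^sub>C (U x + (- l) *\<^sub>C x)"
    using lm by (simp add: part_def minus_divide_right)
  also have "\<dots> = (1 / (l - m)) *\<^sub>C ((U x + (- m) *\<^sub>C x) - (U x + (- l) *\<^sub>C x))"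
    by (simp add: complex_vector.scale_right_diff_distrib)
  also have "\<dots> = (1 / (l - m)) *\<^sub>C (l - m) *\<^sub>C x"
    by (simp add: complex_vector.scale_left_diff_distrib)
  also have "\<dots> = x"
    using lm by simp
  finally show "x \<in> eigenspace U l + eigenspace U m"
    using part[of l m] part[of m l] by (metis add.commute mult.commute set_plus_intro)
qed

lemma eigenspace_plus_self:
  assumes "unitary U"
  shows "eigenspace U l + eigenspace U l = eigenspace U l"
proof
  show "eigenspace U l + eigenspace U l \<subseteq> eigenspace U l"
    using complex_vector.subspace_add[OF subspace_eigenspace[OF assms]] by (auto simp: set_plus_def)
  have "0 \<in> eigenspace U l"
    by (rule complex_vector.subspace_0[OF subspace_eigenspace[OF assms]])
  then show "eigenspace U l \<subseteq> eigenspace U l + eigenspace U l"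
    by (metis add_0 set_plus_intro subsetI)
qed

lemma subspace_eigenspace_plus:
  assumes U: "unitary U"
  shows "complex_vector.subspace (eigenspace U l + eigenspace U m)"
  using complex_vector.subspace_sums[OF subspace_eigenspace[OF U, of l] subspace_eigenspace[OF U, of m]]
  by (rule back_subst) (auto simp: set_plus_def)

lemma closed_eigenspace_plus:
  fixes U :: "'a::complex_inner \<Rightarrow> 'a"
  assumes U: "unitary U"
  shows "closed (eigenspace U l + eigenspace U m)"
proof (cases "l = m")
  case True
  then show ?thesis
    by (simp add: eigenspace_plus_self[OF U] closed_eigenspace[OF U])
next
  case False
  note bl = bounded_linear_unitary[OF U]
  show ?thesis
    unfolding eigenspace_plus_eigenspace[OF U False]
    by (intro closed_Collect_eq continuous_on_add linear_continuous_on bounded_linear_scaleC_right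
        bounded_linear_compose[OF bl bl] bounded_linear_compose[OF bounded_linear_scaleC_right bl])
qed

text \<open>It has to be shown that a vector \<open>q\<close> of the sum orthogonal to \<open>S\<close> and \<open>A ` S\<close> vanishes. For real
  \<open>l\<close> it lies in the eigenspace for \<open>l\<close> and maximality applies at once. Otherwise \<open>S\<close> and \<open>A ` S\<close> lie in
  different summands, so that both components of \<open>q\<close> are orthogonal to them; maximality applies to
  the first component directly and to the second after \<open>A\<close> has carried it to the eigenspace for \<open>l\<close>.\<close>

lemma maximal_paired_system_total:
  fixes A :: "'a::chilbert_space \<Rightarrow> 'a"
  assumes A: "antiunitary A" and S: "maximal_paired_system A l S" and l: "l \<noteq> 1" "cmod l = 1"
  shows "closure (complex_vector.span (S \<union> A ` S)) = eigenspace (A ^^ 2) l + eigenspace (A ^^ 2) (cnj l)"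
proof -
  note U = unitary_antiunitary_square[OF A]
  let ?M = "eigenspace (A ^^ 2) l + eigenspace (A ^^ 2) (cnj l)"
  have Sl: "S \<subseteq> eigenspace (A ^^ 2) l"
    using S by (simp add: maximal_paired_system_def paired_system_def)
  have ASl: "A e \<in> eigenspace (A ^^ 2) (cnj l)" if "e \<in> S" for e
    using antiunitary_eigenspace[OF A] Sl that by blast
  have zero: "0 \<in> eigenspace (A ^^ 2) m" for m
    by (rule complex_vector.subspace_0[OF subspace_eigenspace[OF U]])
  have E: "S \<union> A ` S \<subseteq> ?M"
  proof (intro Un_least image_subsetI subsetI)
    show "e \<in> ?M" if "e \<in> S" for e
      using set_plus_intro[OF subsetD[OF Sl that] zero] by simp
    show "A e \<in> ?M" if "e \<in> S" for e
      using set_plus_intro[OF zero ASl[OF that]] by simp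
  qed
  have "q = 0" if q: "q \<in> ?M" "q \<in> corth_compl (S \<union> A ` S)" for q
  proof (cases "cnj l = l")
    case True
    with q have "q \<in> residual_eigenspace A l S"
      by (simp add: residual_eigenspace_def eigenspace_plus_self[OF U])
    then show ?thesis
      by (rule residual_eigenspace_trivial[OF A S l(1)])
  next
    case False
    obtain a b where ab: "q = a + b" "a \<in> eigenspace (A ^^ 2) l" "b \<in> eigenspace (A ^^ 2) (cnj l)"
      using q(1) by (auto simp: set_plus_def)
    have "cinner e b = 0" "cinner (A e) a = 0" if "e \<in> S" for e
      using cinner_eigenspace_eq_0[OF U l(2) False[symmetric] subsetD[OF Sl that] ab(3)]
        cinner_eigenspace_eq_0[OF U _ False ASl[OF that] ab(2)] l(2) by simp_all
    moreover have "cinner e a + cinner e b = 0" "cinner (A e) a + cinner (A e) b = 0" if "e \<in> S" for e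
      using that q(2) by (auto simp: ab(1) corth_compl_def cinner_add_right)
    ultimately have orth: "cinner e a = 0" "cinner e b = 0" "cinner (A e) a = 0" "cinner (A e) b = 0"
      if "e \<in> S" for e
      using that by simp_all
    have "a \<in> residual_eigenspace A l S"
      using ab(2) orth by (auto simp: residual_eigenspace_def corth_compl_def)
    then have "a = 0"
      by (rule residual_eigenspace_trivial[OF A S l(1)])
    have Ab: "cinner e (A b) = 0" "cinner (A e) (A b) = 0" if "e \<in> S" for e
      using orth[OF that] by (simp_all add: cinner_antiunitary_swap[OF A ab(3), of e] antiunitary_cinner[OF A])
    have "A b \<in> residual_eigenspace A l S"
      using antiunitary_eigenspace[OF A ab(3)] Ab by (auto simp: residual_eigenspace_def corth_compl_def)
    then have "A b = 0"
      by (rule residual_eigenspace_trivial[OF A S l(1)])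
    then have "b = 0"
      using antiunitary_cinner[OF A, of b b] by simp
    with \<open>a = 0\<close> ab(1) show ?thesis
      by simp
  qed
  then have "corth_compl (?M \<inter> corth_compl (S \<union> A ` S)) = UNIV"
    by (intro corth_compl_eq_UNIV) blast
  then show ?thesis
    using closure_span_eq_Int_corth_compl[OF E subspace_eigenspace_plus[OF U] closed_eigenspace_plus[OF U]]
    by simp
qed

lemma orthonormal_basis_paired_system:
  fixes A :: "'a::complex_inner \<Rightarrow> 'a"
  assumes A: "antiunitary A" and S: "paired_system A l S" and m: "cmod m = 1"
  shows "orthonormal_basis (S <+> S) (case_sum (\<lambda>e. e) (\<lambda>e. m *\<^sub>C A e))
    (closure (complex_vector.span (S \<union> A ` S)))"
proof -
  let ?h = "case_sum (\<lambda>e. e) (\<lambda>e. m *\<^sub>C A e)"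
  have mm: "m * cnj m = 1"
    using m complex_norm_square[of m] by simp
  have S': "cinner e f = (if e = f then 1 else 0)" "cinner e (A f) = 0" "cinner (A f) e = 0"
    if "e \<in> S" "f \<in> S" for e f
    using that S cinner_eq_0_commute[of e "A f"] by (auto simp: paired_system_def)
  have onb: "\<forall>i\<in>S <+> S. \<forall>j\<in>S <+> S. cinner (?h i) (?h j) = (if i = j then 1 else 0)"
    using mm by (auto simp: S' cinner_scaleC_left cinner_scaleC_right antiunitary_cinner[OF A] mult.commute
        split: if_splits)
  have im: "?h ` (S <+> S) = S \<union> (\<lambda>e. m *\<^sub>C A e) ` S"
    by (auto simp: Plus_def image_Un image_image)
  have A_eq: "A e = cnj m *\<^sub>C (m *\<^sub>C A e)" for e
    using mm by (simp add: mult.commute)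
  have "complex_vector.span (?h ` (S <+> S)) = complex_vector.span (S \<union> A ` S)"
    unfolding im complex_vector.span_eq
  proof (intro conjI Un_least image_subsetI subsetI)
    show "A e \<in> complex_vector.span (S \<union> (\<lambda>e. m *\<^sub>C A e) ` S)" if "e \<in> S" for e
      using that by (subst A_eq) (intro complex_vector.span_scale complex_vector.span_base, auto)
    show "m *\<^sub>C A e \<in> complex_vector.span (S \<union> A ` S)" if "e \<in> S" for e
      using that by (intro complex_vector.span_scale complex_vector.span_base) auto
  qed (auto intro: complex_vector.span_base)
  with onb show ?thesis
    by (simp add: orthonormal_basis_def)
qed

lemma has_form_sigma_pair:
  fixes A :: "'a::complex_inner \<Rightarrow> 'a"
  assumes A: "antiunitary A" and e: "e \<in> eigenspace (A ^^ 2) (m * m)" and m: "cmod m = 1"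
  shows "has_form_sigma A (vector [vector [0, m], vector [inverse m, 0]]) e (m *\<^sub>C A e)"
proof -
  have m0: "m \<noteq> 0"
    using m by auto
  have mm: "cnj m * m = 1"
    using m complex_norm_square[of m] by (simp add: mult.commute)
  have AA: "A (A e) = (m * m) *\<^sub>C e"
    using e by (simp add: eigenspace_def funpow_2_apply)
  have Aq: "A (c *\<^sub>C m *\<^sub>C A e) = (m * cnj c) *\<^sub>C e" for c
  proof -
    have "A (c *\<^sub>C m *\<^sub>C A e) = (cnj c * m * (cnj m * m)) *\<^sub>C e"
      by (simp only: antiunitary_scaleC[OF A] AA scaleC_scaleC) (simp add: mult_ac)
    then show ?thesis
      unfolding mm by (simp add: mult.commute)
  qed
  have Ap: "A (c *\<^sub>C e) = (inverse m * cnj c) *\<^sub>C m *\<^sub>C A e" for c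
    using m0 by (simp add: antiunitary_scaleC[OF A] mult.commute[of _ m] mult.assoc[symmetric])
  show ?thesis
    unfolding has_form_sigma_def plane_vec_def antiunitary_add[OF A] Aq Ap
    by (simp add: matrix_vector_mult_def sum_2 add.commute)
qed

lemma stabilises_span_if_has_form_sigma:
  assumes "has_form_sigma A M p q"
  shows "stabilises A (complex_vector.span {p, q})"
proof -
  have "complex_vector.span {p, q} = range (plane_vec p q)"
  proof (intro equalityI subsetI)
    fix x
    assume "x \<in> complex_vector.span {p, q}"
    then obtain a b where "x = a *\<^sub>C p + b *\<^sub>C q"
      by (auto simp: complex_vector.span_insert complex_vector.span_singleton algebra_simps)
    then have "x = plane_vec p q (vector [a, b])"
      by (simp add: plane_vec_def)
    then show "x \<in> range (plane_vec p q)"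
      by blast
  next
    fix x
    assume "x \<in> range (plane_vec p q)"
    then obtain c :: "complex ^ 2" where "x = c $ 1 *\<^sub>C p + c $ 2 *\<^sub>C q"
      by (auto simp: plane_vec_def)
    moreover have "c $ 1 *\<^sub>C p + c $ 2 *\<^sub>C q \<in> complex_vector.span {p, q}"
      by (intro complex_vector.span_add complex_vector.span_scale complex_vector.span_base) simp_all
    ultimately show "x \<in> complex_vector.span {p, q}"
      by simp
  qed
  with assms show ?thesis
    by (auto simp: stabilises_def has_form_sigma_def)
qed

text \<open>The dichotomy for \<open>\<lambda> = 1\<close>: either nothing is left over, or a single fixed unit vector spans it.\<close>

lemma residual_eigenspace_dim:
  assumes A: "antiunitary A" and S: "maximal_paired_system A 1 S"
  defines "W \<equiv> residual_eigenspace A 1 S"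
  shows "cfinite_dim W" and "complex_vector.dim W \<le> 1"
    and "complex_vector.dim W = 1 \<longrightarrow> (\<exists>e\<in>W. norm e = 1 \<and> A e = e)"
proof -
  have "\<exists>B. finite B \<and> card B \<le> 1 \<and> W \<subseteq> complex_vector.span B \<and>
    (W \<subseteq> {0} \<or> (\<exists>e\<in>W. norm e = 1 \<and> A e = e))"
  proof (cases "W \<subseteq> {0}")
    case True
    then show ?thesis
      by (intro exI[of _ "{}"]) auto
  next
    case False
    then obtain x where "x \<in> W" "x \<noteq> 0"
      by auto
    then obtain f where f: "f \<in> W" "cinner f f = 1" "A f = f"
      using antiunitary_fixed_unit_vector[OF A subspace_residual_eigenspace[OF A]
          _ residual_eigenspace_stable[OF A S]]
      unfolding W_def by (auto simp: residual_eigenspace_def)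
    have "norm f = 1"
      using f(2) power2_norm_eq_cinner[of f] power2_eq_imp_eq[of "norm f" 1] by simp
    with f residual_eigenspace_one_dim[OF A S] show ?thesis
      unfolding W_def by (intro exI[of _ "{f}"]) auto
  qed
  then obtain B where B: "finite B" "card B \<le> 1" "W \<subseteq> complex_vector.span B"
    "W \<subseteq> {0} \<or> (\<exists>e\<in>W. norm e = 1 \<and> A e = e)"
    by (elim exE conjE) (rule that)
  show "cfinite_dim W"
    using B by (auto simp: cfinite_dim_def)
  show "complex_vector.dim W \<le> 1"
    using complex_vector.dim_le_card[OF B(3,1)] B(2) by simp
  have "complex_vector.dim W = 0" if "W \<subseteq> {0}"
    using complex_vector.dim_le_card[of W "{}"] that by simp
  with B(4) show "complex_vector.dim W = 1 \<longrightarrow> (\<exists>e\<in>W. norm e = 1 \<and> A e = e)"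
    by auto
qed

theorem proposition5p1:
  fixes A :: "'a::chilbert_space \<Rightarrow> 'a" and N :: nat and \<zeta> :: complex
  assumes "antiunitary A"
    and "\<exists>k>0. A ^^ k = id"
    and "N > 0" and "A ^^ (2 * N) = id"
    and "\<zeta> = exp (\<i> * complex_of_real pi / of_nat N)"
  shows
    "unitary (A ^^ 2) \<and>
     orthogonal_direct_sum
       ([eigenspace (A ^^ 2) 1, eigenspace (A ^^ 2) (- 1)] @
        concat (map (\<lambda>n. [eigenspace (A ^^ 2) (\<zeta> powi (2 * n)), eigenspace (A ^^ 2) (\<zeta> powi (- 2 * n))])
          [n \<leftarrow> [1..int N]. real_of_int n < real N / 2])) \<and>
     (\<exists>W. complex_vector.subspace W \<and> W \<subseteq> eigenspace (A ^^ 2) 1 \<and> stabilises A W \<and>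
        cfinite_dim W \<and> complex_vector.dim W \<le> 1 \<and>
        (complex_vector.dim W = 1 \<longrightarrow> (\<exists>e\<in>W. norm e = 1 \<and> A e = e)) \<and>
        (\<forall>n::int. 0 \<le> n \<and> real_of_int n \<le> real N / 2 \<longrightarrow>
           (\<exists>(J :: 'a set) ep em.
              orthonormal_basis (J <+> J) (case_sum ep em)
                (if n > 0
                 then eigenspace (A ^^ 2) (\<zeta> powi (2 * n)) + eigenspace (A ^^ 2) (\<zeta> powi (- 2 * n))
                 else eigenspace (A ^^ 2) 1 \<inter> corth_compl W) \<and>
              (\<forall>j\<in>J. stabilises A (complex_vector.span {ep j, em j}) \<and>
                 has_form_sigma A
                   (vector [vector [0, \<zeta> powi n], vector [\<zeta> powi (- n), 0]]) (ep j) (em j)))))"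
proof -
  note A = assms(1) and N = assms(3)
  note U = unitary_antiunitary_square[OF A]
  have zeta: "\<zeta> = cis (pi / real N)"
    using assms(5) by (simp add: cis_conv_exp)
  have cmod_zeta: "cmod (\<zeta> powi n) = 1" for n
    by (simp add: zeta norm_power_int)
  have powi_double: "\<zeta> powi (2 * n) = \<zeta> powi n * \<zeta> powi n" for n
    by (simp add: zeta cis_power_int cis_mult mult_ac)
  have powi_cnj: "\<zeta> powi (- 2 * n) = cnj (\<zeta> powi (2 * n))" for n
    by (simp add: zeta cis_power_int cis_cnj)
  \<comment> \<open>The angle \<open>2 \<pi> n / N\<close> lies in the interval from \<open>0\<close> to \<open>\<pi>\<close>, where the cosine is injective.\<close>
  have powi_neq_1: "\<zeta> powi (2 * n) \<noteq> 1" if "0 < n" "real_of_int n \<le> real N / 2" for n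
  proof
    assume "\<zeta> powi (2 * n) = 1"
    then have "cos (2 * pi * real_of_int n / real N) = cos 0"
      by (simp add: zeta cis_power_int complex_eq_iff mult_ac)
    then have "2 * pi * real_of_int n / real N = 0"
      using that N by (intro cos_inj_pi[of _ 0]) (auto simp: field_simps)
    with that N show False
      by simp
  qed

  define L where "L = [1, - 1] @ concat (map (\<lambda>n. [\<zeta> powi (2 * n), \<zeta> powi (- 2 * n)])
    [n \<leftarrow> [1..int N]. real_of_int n < real N / 2])"
  have "(A ^^ 2) ^^ N = id"
    using assms(4) by (simp add: funpow_mult)
  then have "orthogonal_direct_sum (map (eigenspace (A ^^ 2)) L)"
    unfolding L_def using roots_of_unity_list[OF N zeta]
    by (intro orthogonal_direct_sum_eigenspaces[OF U _ N])
  then have sum: "orthogonal_direct_sum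
       ([eigenspace (A ^^ 2) 1, eigenspace (A ^^ 2) (- 1)] @
        concat (map (\<lambda>n. [eigenspace (A ^^ 2) (\<zeta> powi (2 * n)), eigenspace (A ^^ 2) (\<zeta> powi (- 2 * n))])
          [n \<leftarrow> [1..int N]. real_of_int n < real N / 2]))"
    by (simp add: L_def map_concat comp_def)

  \<comment> \<open>The matrix forces \<open>e\<^sup>- = \<zeta>\<^sup>n A e\<^sup>+\<close>, so a paired system is a choice of the vectors \<open>e\<^sup>+\<close> and can
    serve as its own index set.\<close>
  have bases: "\<exists>(J :: 'a set) ep em. orthonormal_basis (J <+> J) (case_sum ep em) V \<and>
      (\<forall>j\<in>J. stabilises A (complex_vector.span {ep j, em j}) \<and>
         has_form_sigma A (vector [vector [0, \<zeta> powi n], vector [\<zeta> powi (- n), 0]]) (ep j) (em j))"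
    if S: "paired_system A (\<zeta> powi (2 * n)) S" and V: "closure (complex_vector.span (S \<union> A ` S)) = V"
    for n S V
  proof -
    have form: "has_form_sigma A (vector [vector [0, \<zeta> powi n], vector [\<zeta> powi (- n), 0]]) e (\<zeta> powi n *\<^sub>C A e)"
      if "e \<in> S" for e
      unfolding power_int_minus using that S
      by (intro has_form_sigma_pair[OF A] cmod_zeta) (auto simp: paired_system_def powi_double)
    show ?thesis
      using orthonormal_basis_paired_system[OF A S cmod_zeta] V form stabilises_span_if_has_form_sigma[OF form]
      by blast
  qed

  obtain S where S: "maximal_paired_system A 1 S"
    using maximal_paired_system_exists by blast
  let ?W = "residual_eigenspace A 1 S"
  have PS: "paired_system A 1 S"
    using S by (simp add: maximal_paired_system_def)
  have "S \<union> A ` S \<subseteq> eigenspace (A ^^ 2) 1"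
    using PS antiunitary_eigenspace[OF A, of _ 1] by (auto simp: paired_system_def)
  then have "closure (complex_vector.span (S \<union> A ` S)) = eigenspace (A ^^ 2) 1 \<inter> corth_compl ?W"
    unfolding residual_eigenspace_def
    by (intro closure_span_eq_Int_corth_compl subspace_eigenspace closed_eigenspace U)
  then have basis_0: "\<exists>(J :: 'a set) ep em. orthonormal_basis (J <+> J) (case_sum ep em)
        (eigenspace (A ^^ 2) 1 \<inter> corth_compl ?W) \<and>
      (\<forall>j\<in>J. stabilises A (complex_vector.span {ep j, em j}) \<and>
         has_form_sigma A (vector [vector [0, \<zeta> powi 0], vector [\<zeta> powi (- 0), 0]]) (ep j) (em j))"
    using PS by (intro bases) simp_all
  have basis_pos: "\<exists>(J :: 'a set) ep em. orthonormal_basis (J <+> J) (case_sum ep em)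
        (eigenspace (A ^^ 2) (\<zeta> powi (2 * n)) + eigenspace (A ^^ 2) (\<zeta> powi (- 2 * n))) \<and>
      (\<forall>j\<in>J. stabilises A (complex_vector.span {ep j, em j}) \<and>
         has_form_sigma A (vector [vector [0, \<zeta> powi n], vector [\<zeta> powi (- n), 0]]) (ep j) (em j))"
    if "0 < n" "real_of_int n \<le> real N / 2" for n
  proof -
    obtain T where T: "maximal_paired_system A (\<zeta> powi (2 * n)) T"
      using maximal_paired_system_exists by blast
    have "paired_system A (\<zeta> powi (2 * n)) T"
      using T by (simp add: maximal_paired_system_def)
    then show ?thesis
      unfolding powi_cnj by (rule bases) (rule maximal_paired_system_total[OF A T powi_neq_1[OF that] cmod_zeta])
  qed
  have all_n: "\<exists>(J :: 'a set) ep em.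
              orthonormal_basis (J <+> J) (case_sum ep em)
                (if n > 0
                 then eigenspace (A ^^ 2) (\<zeta> powi (2 * n)) + eigenspace (A ^^ 2) (\<zeta> powi (- 2 * n))
                 else eigenspace (A ^^ 2) 1 \<inter> corth_compl ?W) \<and>
              (\<forall>j\<in>J. stabilises A (complex_vector.span {ep j, em j}) \<and>
                 has_form_sigma A
                   (vector [vector [0, \<zeta> powi n], vector [\<zeta> powi (- n), 0]]) (ep j) (em j))"
    if n: "0 \<le> n \<and> real_of_int n \<le> real N / 2" for n :: int
  proof (cases "n > 0")
    case True
    then show ?thesis
      unfolding if_P[OF True] using n by (intro basis_pos) simp_all
  next
    case False
    then have "n = 0"
      using n by simp
    then show ?thesis
      unfolding if_not_P[OF False] using basis_0 by simp
  qed
  have W_sub: "?W \<subseteq> eigenspace (A ^^ 2) 1"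
    by (auto simp: residual_eigenspace_def)
  have W_stable: "stabilises A ?W"
    using residual_eigenspace_stable[OF A S] by (auto simp: stabilises_def)
  show ?thesis
    by (intro conjI U sum, rule exI[of _ ?W], intro conjI allI impI W_sub W_stable all_n subspace_residual_eigenspace[OF A]
        residual_eigenspace_dim(3)[OF A S, THEN mp] residual_eigenspace_dim[OF A S]) simp_all
qed

end
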